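(* Let $A$ and $B$ be Archimedean $f$-algebras with point separating order duals and with unit elements $e_A$ and $e_B$ respectively, and let $T:A\to B$ be an order bounded linear operator satisfying $T(e_A)=e_B$ and $|Ta|\le e_B$ whenever $a\in A$ and $|a|\le e_A$. Then the following are equivalent: (i) $T$ is an extreme point of the (convex) set of all Markov operators from $A$ to $B$. (ii) For every $a\in A$, $\inf\{T|a-\lambda e_A| : \lambda\in\mathbb{R}\}=0$ (the infimum taken in $B$). (iii) $T$ is a lattice homomorphism.
   Context: A Riesz algebra (lattice-ordered algebra) is a real associative algebra $A$ that is also a Riesz space (vector lattice) such that $ab\ge 0$ whenever $a,b\ge 0$. It is an $f$-algebra if $a\wedge b=0$ implies $ac\wedge b=ca\wedge b=0$ for all $0\le c\in A$. The order dual of $A$ (the space of order bounded linear functionals on $A$) separates points if for every $0\neq a\in A$ there is an order bounded linear functional $\varphi$ on $A$ with $\varphi(a)\neq 0$. A unit element is a multiplicative identity. A Markov operator from $A$ to $B$ is a positive linear operator $S:A\to B$ with $S(e_A)=e_B$. A linear operator is order bounded if it maps order bounded sets to order bounded sets. A lattice homomorphism is a linear operator $T$ with $T(a\vee b)=Ta\vee Tb$ for all $a,b$ (equivalently $|Ta|=T|a|$ for all $a$). *)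

theory Defs
  imports
    "HOL-Analysis.Analysis"
    "HOL-Library.Lattice_Algebras"
    "HOL-Library.Lub_Glb"
    "HOL-Library.Function_Algebras"
begin

section \<open>Riesz algebras and f-algebras\<close>

text \<open>
  The class \<^class>\<open>lattice_ring\<close> provides the lattice structure, the modulus
  \<open>\<bar>a\<bar> = sup a (- a)\<close> and the compatibility of the order with addition and multiplication;
  \<^class>\<open>ordered_real_vector\<close> provides the compatibility with real scalars. The ring need
  not be unital, and the zero algebra is not excluded: units are given as explicit elements
  (\<open>unit_element\<close>) instead of via \<^class>\<open>ring_1\<close>, which requires \<open>0 \<noteq> 1\<close>.
\<close>

class riesz_algebra = lattice_ring + real_algebra + ordered_real_vector

class f_algebra = riesz_algebra +
  assumes inf_mult_right_eq_0: "inf a b = 0 \<Longrightarrow> 0 \<le> c \<Longrightarrow> inf (a * c) b = 0"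
    and inf_mult_left_eq_0: "inf a b = 0 \<Longrightarrow> 0 \<le> c \<Longrightarrow> inf (c * a) b = 0"

class archimedean_f_algebra = f_algebra +
  assumes archimedean:
    "0 \<le> a \<Longrightarrow> 0 \<le> b \<Longrightarrow> (\<And>n::nat. real n *\<^sub>R a \<le> b) \<Longrightarrow> a = 0"

definition unit_element :: "'a::times \<Rightarrow> bool"
  where "unit_element e \<longleftrightarrow> (\<forall>a. e * a = a \<and> a * e = a)"


section \<open>Operators\<close>

definition order_bounded_set :: "'a::order set \<Rightarrow> bool"
  where "order_bounded_set X \<longleftrightarrow> (\<exists>l u. X \<subseteq> {l..u})"

definition order_bounded :: "('a::order \<Rightarrow> 'b::order) \<Rightarrow> bool"
  where "order_bounded T \<longleftrightarrow> (\<forall>X. order_bounded_set X \<longrightarrow> order_bounded_set (T ` X))"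

definition order_dual :: "('a::{order, real_vector} \<Rightarrow> real) set"
  where "order_dual = {\<phi>. linear \<phi> \<and> order_bounded \<phi>}"

definition separates_points :: "('a::zero \<Rightarrow> real) set \<Rightarrow> bool"
  where "separates_points F \<longleftrightarrow> (\<forall>a. a \<noteq> 0 \<longrightarrow> (\<exists>\<phi>\<in>F. \<phi> a \<noteq> 0))"

definition positive_operator :: "('a::ordered_real_vector \<Rightarrow> 'b::ordered_real_vector) \<Rightarrow> bool"
  where "positive_operator S \<longleftrightarrow> linear S \<and> (\<forall>a. 0 \<le> a \<longrightarrow> 0 \<le> S a)"

definition markov_operators ::
    "'a::ordered_real_vector \<Rightarrow> 'b::ordered_real_vector \<Rightarrow> ('a \<Rightarrow> 'b) set"
  where "markov_operators e\<^sub>A e\<^sub>B = {S. positive_operator S \<and> S e\<^sub>A = e\<^sub>B}"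

definition lattice_homomorphism ::
    "('a::{real_vector, lattice} \<Rightarrow> 'b::{real_vector, lattice}) \<Rightarrow> bool"
  where "lattice_homomorphism T \<longleftrightarrow> linear T \<and> (\<forall>a b. T (sup a b) = sup (T a) (T b))"


section \<open>The real vector space of functions\<close>

text \<open>
  Pointwise scalar multiplication, complementing the pointwise addition of
  \<^theory>\<open>HOL-Library.Function_Algebras\<close>, so that \<^const>\<open>extreme_point_of\<close> and
  \<^const>\<open>convex\<close> apply to sets of operators.
\<close>

instantiation "fun" :: (type, real_vector) real_vector
begin

definition scaleR_fun :: "real \<Rightarrow> ('a \<Rightarrow> 'b) \<Rightarrow> 'a \<Rightarrow> 'b"
  where "scaleR_fun r f = (\<lambda>x. r *\<^sub>R f x)"

instance
  by standard (rule ext, simp add: scaleR_fun_def scaleR_add_right scaleR_add_left)+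

end

lemma scaleR_fun_apply [simp]: "(r *\<^sub>R f) x = r *\<^sub>R f x"
  by (simp add: scaleR_fun_def)

lemma convex_markov_operators: "convex (markov_operators e\<^sub>A e\<^sub>B)"
proof (rule convexI)
  fix S T :: "'a \<Rightarrow> 'b" and u v :: real
  assume S: "S \<in> markov_operators e\<^sub>A e\<^sub>B" and T: "T \<in> markov_operators e\<^sub>A e\<^sub>B"
    and uv: "0 \<le> u" "0 \<le> v" "u + v = 1"
  have eq: "u *\<^sub>R S + v *\<^sub>R T = (\<lambda>x. u *\<^sub>R S x + v *\<^sub>R T x)"
    by (rule ext) simp
  have "linear (\<lambda>x. u *\<^sub>R S x + v *\<^sub>R T x)"
    using S T unfolding markov_operators_def positive_operator_def
    by (simp add: linear_compose_add linear_compose_scale_right)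
  moreover have "0 \<le> u *\<^sub>R S x + v *\<^sub>R T x" if "0 \<le> x" for x
    using S T uv(1,2) that unfolding markov_operators_def positive_operator_def
    by (simp add: scaleR_nonneg_nonneg)
  moreover have "u *\<^sub>R S e\<^sub>A + v *\<^sub>R T e\<^sub>A = e\<^sub>B"
    using S T scaleR_left_distrib[of u v e\<^sub>B] uv(3) unfolding markov_operators_def by simp
  ultimately show "u *\<^sub>R S + v *\<^sub>R T \<in> markov_operators e\<^sub>A e\<^sub>B"
    unfolding eq markov_operators_def positive_operator_def by simp
qed

end

theory Submission
  imports Defs
begin

text \<open>
  The engine is the estimate \<open>r (a - r e)\<^sup>+ \<le> a\<^sup>2\<close> for \<open>a \<ge> 0\<close> and \<open>r \<ge> 0\<close> in a unital
  \<open>f\<close>-algebra (\<open>scaleR_pprt_diff_unit_le_square\<close>). It makes the unit behave almost like a strong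
  order unit: the truncations \<open>a \<sqinter> r e\<close> converge to \<open>a\<close> uniformly relative to \<open>a\<^sup>2\<close>, and in an
  Archimedean algebra an inequality survives such limits.

  An operator \<open>T\<close> as in the theorem is a Markov operator (\<open>markov_if_unital_contraction\<close>): if
  \<open>0 \<le> a \<le> e\<close> then \<open>2 a - e\<close> lies in the order interval \<open>[-e, e]\<close>, so \<open>2 T a - e\<close> does, and
  \<open>T a \<ge> 0\<close>; positivity at an arbitrary \<open>a \<ge> 0\<close> follows by truncation and order boundedness.

  If \<open>T\<close> is extreme and \<open>0 \<le> a \<le> e\<close>, put \<open>D x = T (x a) - T x T a\<close>. Both \<open>T + D\<close> and \<open>T - D\<close> are
  Markov operators, so \<open>D = 0\<close>, that is, \<open>T (x a) = T x T a\<close> (\<open>extreme_markov_multiplicative\<close>).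
  Disjoint elements have product zero, so if they are bounded by multiples of the unit, the product
  of their images is zero; as the target has no nonzero positive element of square zero, the images
  are disjoint. By truncation \<open>T\<close> preserves all disjointness, hence is a lattice homomorphism.

  If \<open>T\<close> is a lattice homomorphism, then \<open>T \<bar>a - r e\<bar> = \<bar>T a - r e\<bar>\<close>, and the infimum over \<open>r\<close> of
  \<open>\<bar>b - r e\<bar>\<close> vanishes for every \<open>b\<close> (\<open>Inf_abs_diff_unit\<close>): along a grid of mesh \<open>\<epsilon>\<close> in \<open>[-R, R]\<close>
  every lower bound is at most \<open>\<epsilon> e + 2 (\<bar>b\<bar> - R e)\<^sup>+\<close>, which the truncation estimate makes small.

  Conversely, the vanishing of the infima of \<open>T \<bar>a - r e\<bar>\<close> lets one compare \<open>a\<close> with the scalar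
  multiples of the unit, on which \<open>T\<close> commutes with the modulus and all Markov operators agree.
  Accordingly \<open>T \<bar>a\<bar> - \<bar>T a\<bar>\<close> is bounded by \<open>2 T \<bar>a - r e\<bar>\<close> for every \<open>r\<close>
  (\<open>markov_abs_defect_le\<close>), and if \<open>T\<close> is a proper convex combination of Markov operators \<open>R\<close> and
  \<open>S\<close>, then \<open>\<bar>R a - S a\<bar>\<close> is bounded by a multiple of \<open>T \<bar>a - r e\<bar>\<close>
  (\<open>markov_components_diff_le\<close>). So \<open>T\<close> is a lattice homomorphism and an extreme point.
\<close>

section \<open>Vector lattices\<close>

lemma pprt_diff_of_disjoint:
  fixes p q :: "'a::lattice_ab_group_add"
  assumes "inf p q = 0"
  shows "pprt (p - q) = p"
proof -
  have "pprt (p - q) = sup p q - q"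
    unfolding pprt_def using add_sup_distrib_right[of "p - q" 0 q] by (simp add: algebra_simps)
  also have "\<dots> = p"
    using add_eq_inf_sup[of p q] assms by (simp add: algebra_simps)
  finally show ?thesis .
qed

lemma diff_pprt_eq:
  fixes x :: "'a::lattice_ab_group_add"
  shows "x = pprt x - pprt (- x)"
  using prts[of x] by (simp add: pprt_neg)

text \<open>
  Subtracting \<open>x\<^sup>-\<close> from both arguments leaves \<open>x\<close> and \<open>0\<close>, whose infimum is \<open>- x\<^sup>-\<close>.
\<close>

lemma inf_pprt_pprt_uminus:
  fixes x :: "'a::lattice_ab_group_add"
  shows "inf (pprt x) (pprt (- x)) = 0"
proof -
  have "inf (pprt x) (pprt (- x)) = inf (x + pprt (- x)) (0 + pprt (- x))"
    using diff_pprt_eq[of x] by (simp add: algebra_simps)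
  also have "\<dots> = nprt x + pprt (- x)"
    by (simp only: nprt_def add_inf_distrib_right)
  finally show ?thesis by (simp add: pprt_neg)
qed

lemma diff_inf_eq_pprt:
  fixes a b :: "'a::lattice_ab_group_add"
  shows "a - inf a b = pprt (a - b)"
proof -
  have "a + sup (- a) (- b) = sup (a + - a) (a + - b)" by (rule add_sup_distrib_left)
  then show ?thesis by (simp add: pprt_def neg_inf_eq_sup sup_commute)
qed

text \<open>
  The lattice of a lattice-ordered group is distributive: with \<open>s = b \<squnion> c\<close>, replacing \<open>s\<close> by \<open>b\<close>
  lowers \<open>a \<sqinter> s\<close> by at most \<open>s - b\<close>, replacing it by \<open>c\<close> lowers it by at most \<open>s - c\<close>, and
  \<open>(s - b) \<sqinter> (s - c) = 0\<close>.
\<close>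

lemma inf_sup_le_sup_inf:
  fixes a b c :: "'a::lattice_ab_group_add"
  shows "inf a (sup b c) \<le> sup (inf a b) (inf a c)"
proof -
  let ?s = "sup b c" and ?m = "sup (inf a b) (inf a c)"
  have step: "inf a ?s - ?m + x \<le> ?s" if x: "x \<le> ?s" "inf a x \<le> ?m" for x
  proof -
    have "a \<le> a + (?s - x)" using x(1) by simp
    then have "inf a ?s \<le> inf (a + (?s - x)) (x + (?s - x))" by (simp add: le_infI1)
    also have "\<dots> = inf a x + (?s - x)" by (simp only: add_inf_distrib_right)
    also have "\<dots> \<le> ?m + (?s - x)" using x(2) by (rule add_right_mono)
    finally have "inf a ?s - ?m + x \<le> ?m + (?s - x) - ?m + x"
      by (intro add_right_mono diff_right_mono)
    also have "\<dots> = ?s" by (simp only: add_diff_cancel_left' diff_add_cancel)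
    finally show ?thesis .
  qed
  have "inf a ?s - ?m + ?s = sup (inf a ?s - ?m + b) (inf a ?s - ?m + c)"
    by (rule add_sup_distrib_left)
  also have "\<dots> \<le> ?s" by (intro sup_least step) simp_all
  finally show ?thesis
    by (simp only: add_le_same_cancel1 add_le_same_cancel2 diff_le_0_iff_le)
qed

lemma inf_scaleR:
  fixes a b :: "'a::{lattice_ab_group_add, ordered_real_vector}"
  assumes "0 < r"
  shows "inf (r *\<^sub>R a) (r *\<^sub>R b) = r *\<^sub>R inf a b"
proof (rule antisym)
  have "inverse r *\<^sub>R inf (r *\<^sub>R a) (r *\<^sub>R b) \<le> a" "inverse r *\<^sub>R inf (r *\<^sub>R a) (r *\<^sub>R b) \<le> b"
    using scaleR_left_mono[OF inf_le1[of "r *\<^sub>R a" "r *\<^sub>R b"], of "inverse r"]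
      scaleR_left_mono[OF inf_le2[of "r *\<^sub>R a" "r *\<^sub>R b"], of "inverse r"] assms by simp_all
  then have "r *\<^sub>R (inverse r *\<^sub>R inf (r *\<^sub>R a) (r *\<^sub>R b)) \<le> r *\<^sub>R inf a b"
    using assms by (intro scaleR_left_mono) simp_all
  then show "inf (r *\<^sub>R a) (r *\<^sub>R b) \<le> r *\<^sub>R inf a b" using assms by simp
qed (use assms in \<open>simp add: scaleR_left_mono\<close>)

lemma abs_scaleR_nonneg:
  fixes a :: "'a::{lattice_ab_group_add_abs, ordered_real_vector}"
  assumes "0 \<le> a"
  shows "\<bar>r *\<^sub>R a\<bar> = \<bar>r\<bar> *\<^sub>R a"
proof (cases "0 \<le> r")
  case True
  then show ?thesis using assms by (simp add: scaleR_nonneg_nonneg)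
next
  case False
  then have "0 \<le> (- r) *\<^sub>R a" using assms by (intro scaleR_nonneg_nonneg) simp_all
  moreover have "\<bar>r *\<^sub>R a\<bar> = \<bar>(- r) *\<^sub>R a\<bar>" by simp
  ultimately show ?thesis using False by (metis abs_of_neg abs_of_nonneg not_le)
qed

lemma add_self_le_imp_le:
  fixes a b :: "'a::lattice_ab_group_add"
  assumes "a + a \<le> b + b"
  shows "a \<le> b"
proof -
  have "0 \<le> (b + b) - (a + a)" using assms by simp
  also have "\<dots> = (b - a) + (b - a)" by (rule add_diff_add)
  finally have "0 \<le> b - a" by (simp only: zero_le_double_add_iff_zero_le_single_add)
  then show ?thesis by simp
qed

text \<open>
  One step of the grid argument. In coordinates, \<open>(z - d)\<^sup>+\<close> differs from \<open>z\<^sup>+\<close> only where \<open>z > 0\<close>;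
  there either \<open>z < d\<close> and the distance from \<open>z\<close> to \<open>d\<close> is at most \<open>d \<le> s\<close>, or \<open>z \<ge> d\<close> and this
  distance is \<open>(z - d)\<^sup>+\<close>.
\<close>

lemma le_pprt_shift:
  fixes c d s z :: "'a::lattice_ab_group_add_abs"
  assumes c1: "c \<le> s + pprt z" and c2: "c \<le> \<bar>z - d\<bar>" and d: "0 \<le> d" "d \<le> s"
  shows "c \<le> s + pprt (z - d)"
proof -
  have s: "s \<le> s + pprt (z - d)" and "0 \<le> s" using d by simp_all
  have 1: "z - d \<le> s + pprt (z - d)"
    using \<open>0 \<le> s\<close> add_mono[of 0 s "z - d" "pprt (z - d)"] by (simp add: pprt_def)
  have 2: "inf (s + z) (d - z) \<le> s"
  proof -
    have "inf (s + z) (d - z) + inf (s + z) (d - z) \<le> (s + z) + (d - z)"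
      by (intro add_mono inf_le1 inf_le2)
    also have "\<dots> \<le> s + s" using d by simp
    finally show ?thesis by (rule add_self_le_imp_le)
  qed
  let ?u = "sup (s + z) s"
  have 3: "inf ?u (d - z) \<le> s"
  proof -
    have "inf ?u (d - z) \<le> sup (inf (s + z) (d - z)) (inf s (d - z))"
      using inf_sup_le_sup_inf[of "d - z" "s + z" s] by (simp add: inf_commute)
    also have "\<dots> \<le> s" using 2 by simp
    finally show ?thesis .
  qed
  have "c \<le> inf ?u (sup (z - d) (d - z))"
    using c1 c2 by (simp add: pprt_def add_sup_distrib_left abs_lattice)
  also have "\<dots> \<le> sup (inf ?u (z - d)) (inf ?u (d - z))" by (rule inf_sup_le_sup_inf)
  also have "\<dots> \<le> s + pprt (z - d)"
    using 1 order_trans[OF 3 s] by (intro sup_least) (rule le_infI2)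
  finally show ?thesis .
qed

text \<open>
  The grid runs from \<open>0\<close> to \<open>n \<epsilon>\<close>. The two positive parts measure how far \<open>y\<close> lies to its left
  and to its right; in between, the nearest grid point is at distance at most \<open>\<epsilon>\<close>.
\<close>

lemma le_grid_bound:
  fixes c y e :: "'a::{lattice_ab_group_add_abs, ordered_real_vector}"
  assumes c: "\<And>k::nat. c \<le> \<bar>y - (real k * \<epsilon>) *\<^sub>R e\<bar>" and "0 \<le> e" "0 \<le> \<epsilon>"
  shows "c \<le> \<epsilon> *\<^sub>R e + pprt (- y) + pprt (y - (real n * \<epsilon>) *\<^sub>R e)"
proof (induction n)
  case 0
  have "c \<le> \<bar>y\<bar>" using c[of 0] by simp
  also have "\<dots> = pprt y + pprt (- y)" by (simp add: abs_prts pprt_neg)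
  also have "\<dots> \<le> \<epsilon> *\<^sub>R e + (pprt y + pprt (- y))"
    using assms by (simp add: scaleR_nonneg_nonneg)
  finally show ?case by (simp add: algebra_simps)
next
  case (Suc n)
  have eq: "y - (real (Suc n) * \<epsilon>) *\<^sub>R e = (y - (real n * \<epsilon>) *\<^sub>R e) - \<epsilon> *\<^sub>R e"
    by (simp add: algebra_simps)
  show ?case
    unfolding eq
    by (rule le_pprt_shift[OF Suc.IH])
      (use c[of "Suc n"] assms in \<open>simp_all only: eq scaleR_nonneg_nonneg, simp\<close>)
qed

section \<open>Unital f-algebras\<close>

lemma f_algebra_disjoint_mult_eq_0:
  fixes x y :: "'a::f_algebra"
  assumes "inf x y = 0"
  shows "x * y = 0"
proof -
  have nonneg: "0 \<le> x" "0 \<le> y" using assms by (metis inf_le1, metis inf_le2)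
  then have "inf (x * y) y = 0" using assms inf_mult_right_eq_0 by blast
  then have "inf y (x * y) = 0" by (simp add: inf_commute)
  then have "inf (x * y) (x * y) = 0" using nonneg inf_mult_left_eq_0 by blast
  then show ?thesis by simp
qed

lemma f_algebra_pprt_mult_self:
  fixes x :: "'a::f_algebra"
  shows "pprt x * x = pprt x * pprt x"
proof -
  have "pprt x * x = pprt x * (pprt x - pprt (- x))" using diff_pprt_eq[of x] by simp
  then show ?thesis
    using f_algebra_disjoint_mult_eq_0[OF inf_pprt_pprt_uminus[of x]]
    by (simp add: right_diff_distrib)
qed

lemma f_algebra_square_nonneg:
  fixes x :: "'a::f_algebra"
  shows "0 \<le> x * x"
proof -
  have "x * x = pprt x * x + pprt (- x) * (- x)"
    using diff_pprt_eq[of x]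
    by (metis left_diff_distrib minus_mult_right uminus_add_conv_diff add.commute)
  also have "\<dots> = pprt x * pprt x + pprt (- x) * pprt (- x)"
    by (simp only: f_algebra_pprt_mult_self)
  also have "0 \<le> \<dots>" by simp
  finally show ?thesis .
qed

lemma unit_element_nonneg:
  fixes e :: "'a::f_algebra"
  assumes "unit_element e"
  shows "0 \<le> e"
  using f_algebra_square_nonneg[of e] assms by (simp add: unit_element_def)

text \<open>
  With \<open>p = (a - r e)\<^sup>+\<close>, the product \<open>p (a - r e) = p\<^sup>2\<close> is positive, so \<open>r p \<le> p a \<le> a\<^sup>2\<close>.
\<close>

lemma scaleR_pprt_diff_unit_le_square:
  fixes a e :: "'a::f_algebra"
  assumes e: "unit_element e" and a: "0 \<le> a" and r: "0 \<le> r"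
  shows "r *\<^sub>R pprt (a - r *\<^sub>R e) \<le> a * a"
proof -
  let ?p = "pprt (a - r *\<^sub>R e)"
  have "0 \<le> r *\<^sub>R e" using r unit_element_nonneg[OF e] by (rule scaleR_nonneg_nonneg)
  then have "?p \<le> a" using a by (simp add: pprt_def)
  have "0 \<le> ?p * (a - r *\<^sub>R e)"
    unfolding f_algebra_pprt_mult_self by (rule f_algebra_square_nonneg)
  then have "r *\<^sub>R ?p \<le> ?p * a"
    using e by (simp add: right_diff_distrib unit_element_def)
  also have "\<dots> \<le> a * a" using \<open>?p \<le> a\<close> a by (rule mult_right_mono)
  finally show ?thesis .
qed

lemma archimedean_le_0:
  fixes a b :: "'a::archimedean_f_algebra"
  assumes "\<And>n::nat. real n *\<^sub>R a \<le> b"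
  shows "a \<le> 0"
proof -
  have "0 \<le> b" using assms[of 0] by simp
  have "real n *\<^sub>R pprt a \<le> b" for n
  proof (cases "n = 0")
    case False
    then have n: "0 < real n" by simp
    then have "a \<le> inverse (real n) *\<^sub>R b"
      using scaleR_left_mono[OF assms[of n], of "inverse (real n)"] by simp
    moreover have "0 \<le> inverse (real n) *\<^sub>R b" using \<open>0 \<le> b\<close> by (simp add: scaleR_nonneg_nonneg)
    ultimately have "pprt a \<le> inverse (real n) *\<^sub>R b" by (simp add: pprt_def)
    then show ?thesis using scaleR_left_mono[of "pprt a" _ "real n"] n by fastforce
  qed (use \<open>0 \<le> b\<close> in simp)
  then have "pprt a = 0" using \<open>0 \<le> b\<close> archimedean[of "pprt a" b] by simp
  then show ?thesis by (simp only: le_zero_iff_zero_pprt)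
qed

text \<open>The square of \<open>n w - e\<close> is positive, so \<open>w\<^sup>2 = 0\<close> forces \<open>2 n w \<le> e\<close> for all \<open>n\<close>.\<close>

lemma archimedean_unital_square_eq_0:
  fixes w e :: "'a::archimedean_f_algebra"
  assumes e: "unit_element e" and w: "0 \<le> w" "w * w = 0"
  shows "w = 0"
proof (rule archimedean[OF w(1) unit_element_nonneg[OF e]])
  fix n :: nat
  have "0 \<le> (real n *\<^sub>R w - e) * (real n *\<^sub>R w - e)" by (rule f_algebra_square_nonneg)
  also have "\<dots> = e - (real n *\<^sub>R w + real n *\<^sub>R w)"
    using e w by (simp add: algebra_simps unit_element_def)
  finally have "real n *\<^sub>R w + real n *\<^sub>R w \<le> e" by simp
  moreover have "0 \<le> real n *\<^sub>R w" using w by (simp add: scaleR_nonneg_nonneg)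
  ultimately show "real n *\<^sub>R w \<le> e" by (metis add_increasing order_trans order_refl)
qed

lemma archimedean_unital_disjoint_if_mult_eq_0:
  fixes x y e :: "'a::archimedean_f_algebra"
  assumes e: "unit_element e" and xy: "0 \<le> x" "0 \<le> y" "x * y = 0"
  shows "inf x y = 0"
proof (rule archimedean_unital_square_eq_0[OF e])
  show nonneg: "0 \<le> inf x y" using xy by simp
  have "inf x y * inf x y \<le> x * y" using xy nonneg by (intro mult_mono) simp_all
  then show "inf x y * inf x y = 0" using xy f_algebra_square_nonneg[of "inf x y"] by simp
qed

text \<open>
  Where \<open>b\<close> lies within the range of a grid of mesh \<open>\<epsilon>\<close>, its distance to the grid is at most \<open>\<epsilon>\<close>;
  the part of \<open>b\<close> beyond the range is controlled by truncation. Mesh \<open>1 / m\<close> and range \<open>[-m, m]\<close>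
  make both errors of order \<open>1 / m\<close>.
\<close>

lemma Inf_abs_diff_unit:
  fixes b c e :: "'a::archimedean_f_algebra"
  assumes e: "unit_element e" and c: "\<And>r. c \<le> \<bar>b - r *\<^sub>R e\<bar>"
  shows "c \<le> 0"
proof (rule archimedean_le_0)
  fix m :: nat
  let ?B = "\<bar>b\<bar> * \<bar>b\<bar>"
  have e0: "0 \<le> e" by (rule unit_element_nonneg[OF e])
  have B: "0 \<le> ?B" by (rule f_algebra_square_nonneg)
  show "real m *\<^sub>R c \<le> e + ?B + ?B"
  proof (cases "m = 0")
    case True
    then show ?thesis using e0 B by simp
  next
    case False
    then have m: "0 < real m" by simp
    define p where "p = pprt (\<bar>b\<bar> - real m *\<^sub>R e)"
    \<comment> \<open>Shifting by \<open>m e\<close> moves the range \<open>[-m, m]\<close> to \<open>[0, 2 m]\<close>, which takes \<open>2 m\<^sup>2\<close> steps of \<open>1 / m\<close>.\<close>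
    have "c \<le> inverse (real m) *\<^sub>R e + pprt (- (b + real m *\<^sub>R e))
        + pprt (b + real m *\<^sub>R e - (real (2 * m * m) * inverse (real m)) *\<^sub>R e)"
    proof (rule le_grid_bound[OF _ e0])
      show "c \<le> \<bar>b + real m *\<^sub>R e - (real k * inverse (real m)) *\<^sub>R e\<bar>" for k
        using c[of "real k * inverse (real m) - real m"] by (simp add: algebra_simps)
    qed simp
    also have "pprt (- (b + real m *\<^sub>R e)) \<le> p"
      unfolding p_def by (rule pprt_mono) (simp add: abs_ge_minus_self)
    also have "b + real m *\<^sub>R e - (real (2 * m * m) * inverse (real m)) *\<^sub>R e = b - real m *\<^sub>R e"
      using m by (simp add: algebra_simps flip: scaleR_left.add)
    also have "pprt (b - real m *\<^sub>R e) \<le> p"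
      unfolding p_def by (rule pprt_mono) (simp add: abs_ge_self)
    finally have "c \<le> inverse (real m) *\<^sub>R e + p + p" by simp
    then have "real m *\<^sub>R c \<le> real m *\<^sub>R (inverse (real m) *\<^sub>R e + p + p)"
      by (rule scaleR_left_mono) simp
    also have "\<dots> = e + real m *\<^sub>R p + real m *\<^sub>R p" using m by (simp add: scaleR_add_right)
    also have "\<dots> \<le> e + ?B + ?B"
      using scaleR_pprt_diff_unit_le_square[OF e, of "\<bar>b\<bar>" "real m"] unfolding p_def
      by (intro add_mono) simp_all
    finally show ?thesis .
  qed
qed

section \<open>Positive operators\<close>

lemma positive_operator_mono:
  assumes "positive_operator S" "a \<le> b"
  shows "S a \<le> S b"
proof -
  have "0 \<le> S (b - a)" using assms by (simp add: positive_operator_def)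
  then show ?thesis using assms by (simp add: positive_operator_def linear_diff)
qed

lemma positive_operator_abs_le:
  fixes S :: "'a::{lattice_ab_group_add_abs, ordered_real_vector}
    \<Rightarrow> 'b::{lattice_ab_group_add_abs, ordered_real_vector}"
  assumes "positive_operator S"
  shows "\<bar>S a\<bar> \<le> S \<bar>a\<bar>"
proof (rule abs_leI)
  show "S a \<le> S \<bar>a\<bar>" using assms by (rule positive_operator_mono) (rule abs_ge_self)
  have "S (- a) \<le> S \<bar>a\<bar>" using assms by (rule positive_operator_mono) (rule abs_ge_minus_self)
  then show "- S a \<le> S \<bar>a\<bar>" using assms by (simp add: positive_operator_def linear_neg)
qed

text \<open>A linear operator commutes with \<open>\<squnion>\<close> as soon as it does with positive parts, since
  \<open>a \<squnion> b = a + (b - a)\<^sup>+\<close>.\<close>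

lemma lattice_homomorphism_if_pprt:
  fixes T :: "'a::{lattice_ab_group_add, ordered_real_vector}
    \<Rightarrow> 'b::{lattice_ab_group_add, ordered_real_vector}"
  assumes lin: "linear T" and pprt: "\<And>x. T (pprt x) = pprt (T x)"
  shows "lattice_homomorphism T"
proof -
  have sup_eq: "sup a b = a + pprt (b - a)" for a b :: "'c::lattice_ab_group_add"
    by (simp add: pprt_def add_sup_distrib_left sup_commute)
  show ?thesis
    unfolding lattice_homomorphism_def sup_eq using lin pprt
    by (simp add: linear_add linear_diff)
qed

lemma lattice_homomorphism_if_disjointness_preserving:
  fixes T :: "'a::{lattice_ab_group_add, ordered_real_vector}
    \<Rightarrow> 'b::{lattice_ab_group_add, ordered_real_vector}"
  assumes lin: "linear T" and disj: "\<And>a b. inf a b = 0 \<Longrightarrow> inf (T a) (T b) = 0"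
  shows "lattice_homomorphism T"
proof (rule lattice_homomorphism_if_pprt[OF lin])
  fix x
  have "T x = T (pprt x) - T (pprt (- x))"
    using linear_diff[OF lin] diff_pprt_eq[of x] by metis
  then show "T (pprt x) = pprt (T x)"
    using pprt_diff_of_disjoint[OF disj[OF inf_pprt_pprt_uminus[of x]]] by simp
qed

lemma lattice_homomorphism_abs:
  fixes T :: "'a::{lattice_ab_group_add_abs, ordered_real_vector}
    \<Rightarrow> 'b::{lattice_ab_group_add_abs, ordered_real_vector}"
  assumes "lattice_homomorphism T"
  shows "T \<bar>a\<bar> = \<bar>T a\<bar>"
  using assms by (simp add: lattice_homomorphism_def abs_lattice linear_neg)

lemma lattice_homomorphism_if_abs:
  fixes T :: "'a::{lattice_ab_group_add_abs, ordered_real_vector}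
    \<Rightarrow> 'b::{lattice_ab_group_add_abs, ordered_real_vector}"
  assumes lin: "linear T" and abs: "\<And>a. T \<bar>a\<bar> = \<bar>T a\<bar>"
  shows "lattice_homomorphism T"
proof (rule lattice_homomorphism_if_pprt[OF lin])
  fix x
  have double: "pprt y + pprt y = y + \<bar>y\<bar>" for y :: "'c::lattice_ab_group_add_abs"
    using arg_cong2[OF prts[of y] abs_prts[of y], of "(+)"] by simp
  have "T (pprt x) + T (pprt x) = pprt (T x) + pprt (T x)"
    using lin abs by (simp add: double flip: linear_add[OF lin]) (simp add: linear_add)
  then have "2 *\<^sub>R T (pprt x) = 2 *\<^sub>R pprt (T x)" by (simp add: scaleR_2)
  then show "T (pprt x) = pprt (T x)" by simp
qed

text \<open>
  The interval condition gives positivity on \<open>[0, e]\<close> because \<open>a \<mapsto> 2 a - e\<close> maps \<open>[0, e]\<close> into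
  \<open>[-e, e]\<close>. Order boundedness carries the uniform convergence of the truncations over to their
  images, which extends positivity to all of the cone.
\<close>

lemma markov_if_unital_contraction:
  fixes T :: "'a::archimedean_f_algebra \<Rightarrow> 'b::archimedean_f_algebra"
  assumes eA: "unit_element e\<^sub>A" and lin: "linear T" and bdd: "order_bounded T"
    and unital: "T e\<^sub>A = e\<^sub>B" and contr: "\<And>a. \<bar>a\<bar> \<le> e\<^sub>A \<Longrightarrow> \<bar>T a\<bar> \<le> e\<^sub>B"
  shows "T \<in> markov_operators e\<^sub>A e\<^sub>B"
proof -
  have unit: "0 \<le> T a" if "0 \<le> a" "a \<le> e\<^sub>A" for a
  proof -
    have "\<bar>a + a - e\<^sub>A\<bar> \<le> e\<^sub>A"
      using that add_mono[OF that(2) that(2)] by (intro abs_leI) (simp_all add: algebra_simps)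
    from contr[OF this] have "- (T a + T a - e\<^sub>B) \<le> e\<^sub>B"
      using lin unital by (simp add: linear_add linear_diff abs_le_iff)
    from add_left_mono[OF this, of "T a + T a - e\<^sub>B"] have "0 + 0 \<le> T a + T a" by simp
    then show ?thesis by (rule add_self_le_imp_le)
  qed
  have "0 \<le> T a" if a: "0 \<le> a" for a
  proof -
    have "order_bounded_set {0..a * a}" by (auto simp: order_bounded_set_def)
    then have "order_bounded_set (T ` {0..a * a})" using bdd by (simp add: order_bounded_def)
    then obtain l u where lu: "T ` {0..a * a} \<subseteq> {l..u}" by (auto simp: order_bounded_set_def)
    have "- T a \<le> 0"
    proof (rule archimedean_le_0)
      fix n :: nat
      show "real n *\<^sub>R (- T a) \<le> - l"
      proof (cases "n = 0")
        case True
        have "0 \<in> {0..a * a}" by (simp add: f_algebra_square_nonneg)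
        then have "l \<le> T 0" using lu by fastforce
        then show ?thesis using True lin by (simp add: linear_0)
      next
        case False
        then have n: "0 < real n" by simp
        let ?t = "inf a (real n *\<^sub>R e\<^sub>A)"
        have "0 \<le> T (inverse (real n) *\<^sub>R ?t)"
        proof (rule unit)
          show "0 \<le> inverse (real n) *\<^sub>R ?t"
            using a unit_element_nonneg[OF eA] by (simp add: scaleR_nonneg_nonneg)
          show "inverse (real n) *\<^sub>R ?t \<le> e\<^sub>A"
            using scaleR_left_mono[OF inf_le2[of a "real n *\<^sub>R e\<^sub>A"], of "inverse (real n)"] n
            by simp
        qed
        then have "0 \<le> real n *\<^sub>R T (inverse (real n) *\<^sub>R ?t)"
          by (intro scaleR_nonneg_nonneg) simp
        then have t: "0 \<le> T ?t" using n lin by (simp add: linear_scale)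
        have "real n *\<^sub>R (a - ?t) \<in> {0..a * a}"
          unfolding diff_inf_eq_pprt
          using scaleR_pprt_diff_unit_le_square[OF eA a, of "real n"]
          by (simp add: scaleR_nonneg_nonneg)
        then have "l \<le> T (real n *\<^sub>R (a - ?t))" using lu by fastforce
        also have "\<dots> = real n *\<^sub>R T a - real n *\<^sub>R T ?t"
          using lin by (simp only: linear_scale linear_diff scaleR_diff_right)
        also have "\<dots> \<le> real n *\<^sub>R T a" using t by (simp add: scaleR_nonneg_nonneg)
        finally show ?thesis by simp
      qed
    qed
    then show ?thesis by simp
  qed
  then show ?thesis using lin unital by (simp add: markov_operators_def positive_operator_def)
qed

section \<open>Extreme Markov operators\<close>

lemma not_extreme_if_symmetric_perturbation:
  fixes T D :: "'v::real_vector"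
  assumes ext: "T extreme_point_of K" and "T + D \<in> K" "T - D \<in> K"
  shows "D = 0"
proof (rule ccontr)
  assume "D \<noteq> 0"
  have "T - D \<noteq> T + D"
  proof
    assume "T - D = T + D"
    then have "2 *\<^sub>R D = 0" by (simp add: scaleR_2 algebra_simps)
    then show False using \<open>D \<noteq> 0\<close> by simp
  qed
  moreover have "T = (1 - 1 / 2) *\<^sub>R (T - D) + (1 / 2) *\<^sub>R (T + D)"
    by (simp add: algebra_simps flip: scaleR_left.add)
  ultimately have "T \<in> open_segment (T - D) (T + D)"
    unfolding in_segment by (intro conjI exI[of _ "1 / 2"]) simp_all
  then show False using assms by (auto simp: extreme_point_of_def)
qed

text \<open>
  The perturbation \<open>D x = T (x a) - T x T a\<close> vanishes at the unit and is dominated by \<open>T\<close> on the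
  positive cone: \<open>T x + D x = T (x a) + T x (e - T a)\<close> and \<open>T x - D x = T (x (e - a)) + T x T a\<close>.
\<close>

lemma extreme_markov_multiplicative:
  fixes T :: "'a::f_algebra \<Rightarrow> 'b::f_algebra"
  assumes eA: "unit_element e\<^sub>A" and eB: "unit_element e\<^sub>B"
    and ext: "T extreme_point_of markov_operators e\<^sub>A e\<^sub>B"
    and a: "0 \<le> a" "a \<le> e\<^sub>A"
  shows "T (x * a) = T x * T a"
proof -
  have T: "positive_operator T" and lin: "linear T" and unital: "T e\<^sub>A = e\<^sub>B"
    using ext by (simp_all add: extreme_point_of_def markov_operators_def positive_operator_def)
  have pos: "0 \<le> T x" if "0 \<le> x" for x using T that by (simp add: positive_operator_def)
  have Ta: "0 \<le> T a" "T a \<le> e\<^sub>B"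
    using pos[OF a(1)] positive_operator_mono[OF T a(2)] unital by simp_all
  define D where "D = (\<lambda>x. T (x * a) - T x * T a)"
  have linD: "linear D"
    unfolding D_def using lin
    by (intro linearI) (simp_all add: linear_add linear_scale algebra_simps)
  have De: "D e\<^sub>A = 0" using eA eB unital by (simp add: D_def unit_element_def)
  have "T + D \<in> markov_operators e\<^sub>A e\<^sub>B"
    unfolding markov_operators_def positive_operator_def
  proof (intro CollectI conjI allI impI)
    show "linear (T + D)" using linear_compose_add[OF lin linD] by (simp add: plus_fun_def)
    show "(T + D) e\<^sub>A = e\<^sub>B" using De unital by simp
    fix x :: 'a assume x: "0 \<le> x"
    have "(T + D) x = T (x * a) + T x * (e\<^sub>B - T a)"
      using eB by (simp add: D_def right_diff_distrib unit_element_def)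
    also have "0 \<le> \<dots>"
      using pos[OF x] pos[of "x * a"] x a Ta by simp
    finally show "0 \<le> (T + D) x" .
  qed
  moreover have "T - D \<in> markov_operators e\<^sub>A e\<^sub>B"
    unfolding markov_operators_def positive_operator_def
  proof (intro CollectI conjI allI impI)
    show "linear (T - D)" using linear_compose_sub[OF lin linD] by (simp add: fun_diff_def)
    show "(T - D) e\<^sub>A = e\<^sub>B" using De unital by simp
    fix x :: 'a assume x: "0 \<le> x"
    have "(T - D) x = T (x * (e\<^sub>A - a)) + T x * T a"
      using eA lin by (simp add: D_def right_diff_distrib unit_element_def linear_diff)
    also have "0 \<le> \<dots>"
      using pos[OF x] pos[of "x * (e\<^sub>A - a)"] x a Ta by simp
    finally show "0 \<le> (T - D) x" .
  qed
  ultimately have "D = 0" by (rule not_extreme_if_symmetric_perturbation[OF ext])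
  then have "D x = 0" by simp
  then show ?thesis by (simp add: D_def)
qed

text \<open>
  Multiplicativity turns disjointness of bounded elements into disjointness of their images. For
  arbitrary \<open>a, b\<close> the truncations at \<open>n e\<close> are bounded up to the factor \<open>n\<close>, and the truncation
  error gives \<open>n (T a \<sqinter> T b) \<le> T (a\<^sup>2) + T (b\<^sup>2)\<close>.
\<close>

lemma extreme_markov_lattice_homomorphism:
  fixes T :: "'a::archimedean_f_algebra \<Rightarrow> 'b::archimedean_f_algebra"
  assumes eA: "unit_element e\<^sub>A" and eB: "unit_element e\<^sub>B"
    and ext: "T extreme_point_of markov_operators e\<^sub>A e\<^sub>B"
  shows "lattice_homomorphism T"
proof -
  have T: "positive_operator T" and lin: "linear T"
    using ext by (simp_all add: extreme_point_of_def markov_operators_def positive_operator_def)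
  have pos: "0 \<le> T x" if "0 \<le> x" for x using T that by (simp add: positive_operator_def)
  have e0: "0 \<le> e\<^sub>A" by (rule unit_element_nonneg[OF eA])
  show ?thesis
  proof (rule lattice_homomorphism_if_disjointness_preserving[OF lin])
    fix a b :: 'a assume ab: "inf a b = 0"
    have a: "0 \<le> a" and b: "0 \<le> b" using ab by (metis inf_le1, metis inf_le2)
    have "inf (T a) (T b) \<le> 0"
    proof (rule archimedean_le_0)
      fix n :: nat
      show "real n *\<^sub>R inf (T a) (T b) \<le> T (a * a) + T (b * b)"
      proof (cases "n = 0")
        case True
        then show ?thesis using pos[of "a * a"] pos[of "b * b"] by (simp add: f_algebra_square_nonneg)
      next
        case False
        then have n: "0 < real n" by simp
        \<comment> \<open>\<open>t\<close> truncates at \<open>n e\<close>; \<open>s\<close> rescales the truncation into \<open>[0, e]\<close>, where \<open>T\<close> is multiplicative.\<close>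
        define t where "t x = inf x (real n *\<^sub>R e\<^sub>A)" for x
        define s where "s x = inverse (real n) *\<^sub>R t x" for x
        have t_le: "t x \<le> x" for x by (simp add: t_def)
        have t0: "0 \<le> t x" if "0 \<le> x" for x
          using that e0 by (simp add: t_def scaleR_nonneg_nonneg)
        have s0: "0 \<le> s x" if "0 \<le> x" for x
          using t0[OF that] by (simp add: s_def scaleR_nonneg_nonneg)
        have s_le: "s x \<le> e\<^sub>A" for x
          using scaleR_left_mono[OF inf_le2[of x "real n *\<^sub>R e\<^sub>A"], of "inverse (real n)"] n
          by (simp add: s_def t_def)
        have Tt: "T (t x) = real n *\<^sub>R T (s x)" for x
          using n lin by (simp add: s_def linear_scale)
        have err: "real n *\<^sub>R (T x - T (t x)) \<le> T (x * x)" if "0 \<le> x" for x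
        proof -
          have "real n *\<^sub>R (x - t x) \<le> x * x"
            unfolding t_def diff_inf_eq_pprt
            using scaleR_pprt_diff_unit_le_square[OF eA that, of "real n"] by simp
          from positive_operator_mono[OF T this] show ?thesis
            using lin by (simp add: linear_scale linear_diff)
        qed
        have "inf (t a) (t b) = 0"
          using t0[OF a] t0[OF b] inf_mono[OF t_le[of a] t_le[of b]] ab by (simp add: order_antisym)
        then have "t a * t b = 0" by (rule f_algebra_disjoint_mult_eq_0)
        then have "s a * s b = 0" by (simp add: s_def)
        then have "T (s a) * T (s b) = 0"
          using extreme_markov_multiplicative[OF eA eB ext s0[OF b] s_le, of "s a"] lin
          by (simp add: linear_0)
        then have "inf (T (s a)) (T (s b)) = 0"
          using archimedean_unital_disjoint_if_mult_eq_0[OF eB] pos s0 a b by blast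
        then have disj: "inf (T (t a)) (T (t b)) = 0"
          using inf_scaleR[OF n, of "T (s a)" "T (s b)"] by (simp add: Tt)
        define u v where "u = T a - T (t a)" and "v = T b - T (t b)"
        have "0 \<le> u" "0 \<le> v"
          using positive_operator_mono[OF T t_le] by (simp_all add: u_def v_def)
        have "inf (T a) (T b) \<le> inf (T (t a) + (u + v)) (T (t b) + (u + v))"
          using \<open>0 \<le> u\<close> \<open>0 \<le> v\<close> by (intro inf_mono) (simp_all add: u_def v_def algebra_simps)
        also have "\<dots> = u + v"
          using disj by (simp flip: add_inf_distrib_right)
        finally have "real n *\<^sub>R inf (T a) (T b) \<le> real n *\<^sub>R (u + v)"
          by (rule scaleR_left_mono) simp
        also have "\<dots> \<le> T (a * a) + T (b * b)"
          using err[OF a] err[OF b] unfolding scaleR_add_right u_def v_def by (rule add_mono)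
        finally show ?thesis .
      qed
    qed
    moreover have "0 \<le> inf (T a) (T b)" using pos[OF a] pos[OF b] by simp
    ultimately show "inf (T a) (T b) = 0" by (rule order_antisym)
  qed
qed

section \<open>Approximation by scalars\<close>

text \<open>
  For every \<open>r\<close>, both \<open>T \<bar>a\<bar>\<close> and \<open>\<bar>T a\<bar>\<close> are within \<open>T \<bar>a - r e\<bar>\<close> of \<open>\<bar>r\<bar> e\<close>.
\<close>

lemma markov_abs_defect_le:
  fixes T :: "'a::f_algebra \<Rightarrow> 'b::f_algebra"
  assumes eA: "unit_element e\<^sub>A" and eB: "unit_element e\<^sub>B"
    and T: "T \<in> markov_operators e\<^sub>A e\<^sub>B"
  shows "T \<bar>a\<bar> - \<bar>T a\<bar> \<le> 2 *\<^sub>R T \<bar>a - r *\<^sub>R e\<^sub>A\<bar>"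
proof -
  have pos: "positive_operator T" and lin: "linear T" and unital: "T e\<^sub>A = e\<^sub>B"
    using T by (simp_all add: markov_operators_def positive_operator_def)
  let ?d = "T \<bar>a - r *\<^sub>R e\<^sub>A\<bar>"
  have absA: "\<bar>r *\<^sub>R e\<^sub>A\<bar> = \<bar>r\<bar> *\<^sub>R e\<^sub>A" and absB: "\<bar>r *\<^sub>R e\<^sub>B\<bar> = \<bar>r\<bar> *\<^sub>R e\<^sub>B"
    using unit_element_nonneg[OF eA] unit_element_nonneg[OF eB] by (simp_all add: abs_scaleR_nonneg)
  have "\<bar>a\<bar> \<le> \<bar>a - r *\<^sub>R e\<^sub>A\<bar> + \<bar>r\<bar> *\<^sub>R e\<^sub>A"
    using abs_triangle_ineq[of "a - r *\<^sub>R e\<^sub>A" "r *\<^sub>R e\<^sub>A"] by (simp add: absA)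
  from positive_operator_mono[OF pos this] have 1: "T \<bar>a\<bar> \<le> ?d + \<bar>r\<bar> *\<^sub>R e\<^sub>B"
    using lin unital by (simp add: linear_add linear_scale)
  have "\<bar>r\<bar> *\<^sub>R e\<^sub>B \<le> \<bar>T a\<bar> + \<bar>T (a - r *\<^sub>R e\<^sub>A)\<bar>"
    using abs_triangle_ineq4[of "T a" "T (a - r *\<^sub>R e\<^sub>A)"] lin unital
    by (simp add: linear_diff linear_scale absB)
  also have "\<dots> \<le> \<bar>T a\<bar> + ?d" using positive_operator_abs_le[OF pos] by simp
  finally have 2: "\<bar>r\<bar> *\<^sub>R e\<^sub>B \<le> \<bar>T a\<bar> + ?d" .
  have "T \<bar>a\<bar> \<le> ?d + (\<bar>T a\<bar> + ?d)" using 1 2 by (meson add_left_mono order_trans)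
  then show ?thesis by (simp add: scaleR_2 algebra_simps)
qed

text \<open>
  As \<open>R\<close> and \<open>S\<close> agree on the multiples of the unit, \<open>\<bar>R a - S a\<bar> \<le> (R + S) \<bar>a - r e\<bar>\<close>. The factor
  \<open>u (1 - u)\<close> is below both weights, so it turns \<open>R + S\<close> into a lower bound of the convex
  combination on the positive cone.
\<close>

lemma markov_components_diff_le:
  fixes R S :: "'a::f_algebra \<Rightarrow> 'b::f_algebra"
  assumes R: "R \<in> markov_operators e\<^sub>A e\<^sub>B" and S: "S \<in> markov_operators e\<^sub>A e\<^sub>B"
    and u: "0 < u" "u < 1"
  shows "(u * (1 - u)) *\<^sub>R \<bar>R a - S a\<bar> \<le> ((1 - u) *\<^sub>R R + u *\<^sub>R S) \<bar>a - r *\<^sub>R e\<^sub>A\<bar>"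
proof -
  let ?x = "a - r *\<^sub>R e\<^sub>A"
  have pos: "positive_operator R" "positive_operator S" and lin: "linear R" "linear S"
    and unital: "R e\<^sub>A = e\<^sub>B" "S e\<^sub>A = e\<^sub>B"
    using R S by (simp_all add: markov_operators_def positive_operator_def)
  have "0 \<le> R \<bar>?x\<bar>" "0 \<le> S \<bar>?x\<bar>" using pos by (simp_all add: positive_operator_def)
  have "R a - S a = R ?x - S ?x" using lin unital by (simp add: linear_diff linear_scale)
  then have "\<bar>R a - S a\<bar> \<le> \<bar>R ?x\<bar> + \<bar>S ?x\<bar>" using abs_triangle_ineq4[of "R ?x" "S ?x"] by simp
  also have "\<dots> \<le> R \<bar>?x\<bar> + S \<bar>?x\<bar>" using pos by (intro add_mono positive_operator_abs_le)
  finally have "(u * (1 - u)) *\<^sub>R \<bar>R a - S a\<bar> \<le> (u * (1 - u)) *\<^sub>R (R \<bar>?x\<bar> + S \<bar>?x\<bar>)"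
    using u by (intro scaleR_left_mono) simp_all
  also have "\<dots> = (u * (1 - u)) *\<^sub>R R \<bar>?x\<bar> + (u * (1 - u)) *\<^sub>R S \<bar>?x\<bar>" by (rule scaleR_add_right)
  also have "\<dots> \<le> (1 - u) *\<^sub>R R \<bar>?x\<bar> + u *\<^sub>R S \<bar>?x\<bar>"
    using u \<open>0 \<le> R \<bar>?x\<bar>\<close> \<open>0 \<le> S \<bar>?x\<bar>\<close>
    by (intro add_mono scaleR_right_mono) (simp_all add: mult_left_le mult_left_le_one_le)
  finally show ?thesis by simp
qed

lemma isGlb_UNIV_range_iff:
  fixes f :: "'i \<Rightarrow> 'b::order"
  shows "isGlb UNIV (range f) l \<longleftrightarrow> (\<forall>i. l \<le> f i) \<and> (\<forall>c. (\<forall>i. c \<le> f i) \<longrightarrow> c \<le> l)"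
  by (auto simp: isGlb_def isLb_def greatestP_def setge_def setle_def)

theorem theorem1:
  fixes T :: "'a::archimedean_f_algebra \<Rightarrow> 'b::archimedean_f_algebra"
    and e\<^sub>A :: 'a and e\<^sub>B :: 'b
  assumes "separates_points (order_dual :: ('a \<Rightarrow> real) set)"
    and "separates_points (order_dual :: ('b \<Rightarrow> real) set)"
    and "unit_element e\<^sub>A" and "unit_element e\<^sub>B"
    and "linear T" and "order_bounded T"
    and "T e\<^sub>A = e\<^sub>B"
    and "\<And>a. \<bar>a\<bar> \<le> e\<^sub>A \<Longrightarrow> \<bar>T a\<bar> \<le> e\<^sub>B"
  shows "(T extreme_point_of markov_operators e\<^sub>A e\<^sub>B
            \<longleftrightarrow> (\<forall>a. isGlb UNIV (range (\<lambda>r::real. T \<bar>a - r *\<^sub>R e\<^sub>A\<bar>)) 0))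
       \<and> ((\<forall>a. isGlb UNIV (range (\<lambda>r::real. T \<bar>a - r *\<^sub>R e\<^sub>A\<bar>)) 0)
            \<longleftrightarrow> lattice_homomorphism T)"
    (is "(?ext \<longleftrightarrow> ?inf) \<and> (?inf \<longleftrightarrow> ?hom)")
proof -
  note eA = assms(3) and eB = assms(4) and lin = assms(5)
  have T: "T \<in> markov_operators e\<^sub>A e\<^sub>B"
    using eA lin assms(6-8) by (rule markov_if_unital_contraction)
  then have pos: "positive_operator T" by (simp add: markov_operators_def)
  have ext_hom: ?hom if ?ext
    using eA eB that by (rule extreme_markov_lattice_homomorphism)
  have hom_inf: ?inf if ?hom
  proof -
    have eq: "T \<bar>a - r *\<^sub>R e\<^sub>A\<bar> = \<bar>T a - r *\<^sub>R e\<^sub>B\<bar>" for a r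
      using lattice_homomorphism_abs[OF that] lin assms(7) by (simp add: linear_diff linear_scale)
    show ?thesis
      unfolding isGlb_UNIV_range_iff eq using Inf_abs_diff_unit[OF eB] by auto
  qed
  have inf_le: "c \<le> 0" if ?inf "\<And>r. c \<le> T \<bar>a - r *\<^sub>R e\<^sub>A\<bar>" for c a
    using that unfolding isGlb_UNIV_range_iff by blast
  have inf_hom: ?hom if ?inf
  proof (rule lattice_homomorphism_if_abs[OF lin])
    fix a
    have "(1 / 2) *\<^sub>R (T \<bar>a\<bar> - \<bar>T a\<bar>) \<le> 0"
    proof (rule inf_le[OF that])
      show "(1 / 2) *\<^sub>R (T \<bar>a\<bar> - \<bar>T a\<bar>) \<le> T \<bar>a - r *\<^sub>R e\<^sub>A\<bar>" for r
        using scaleR_left_mono[OF markov_abs_defect_le[OF eA eB T, of a r], of "1 / 2"] by simp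
    qed
    then have "2 *\<^sub>R ((1 / 2) *\<^sub>R (T \<bar>a\<bar> - \<bar>T a\<bar>)) \<le> 2 *\<^sub>R 0"
      by (rule scaleR_left_mono) simp
    then have "T \<bar>a\<bar> \<le> \<bar>T a\<bar>" by simp
    then show "T \<bar>a\<bar> = \<bar>T a\<bar>" using positive_operator_abs_le[OF pos] by (rule order_antisym)
  qed
  have inf_ext: ?ext if ?inf
    unfolding extreme_point_of_def
  proof (intro conjI ballI notI)
    show "T \<in> markov_operators e\<^sub>A e\<^sub>B" by (rule T)
    fix R S assume RS: "R \<in> markov_operators e\<^sub>A e\<^sub>B" "S \<in> markov_operators e\<^sub>A e\<^sub>B"
      and "T \<in> open_segment R S"
    then obtain u where "R \<noteq> S" and u: "0 < u" "u < 1" and Teq: "T = (1 - u) *\<^sub>R R + u *\<^sub>R S"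
      by (auto simp: in_segment)
    have "R a = S a" for a
    proof -
      have "(u * (1 - u)) *\<^sub>R \<bar>R a - S a\<bar> \<le> 0"
        using inf_le[OF that, of _ a] markov_components_diff_le[OF RS u, of a] unfolding Teq by blast
      moreover have "0 \<le> (u * (1 - u)) *\<^sub>R \<bar>R a - S a\<bar>"
        using u by (intro scaleR_nonneg_nonneg) simp_all
      ultimately have "(u * (1 - u)) *\<^sub>R \<bar>R a - S a\<bar> = 0" by (rule order_antisym)
      then show ?thesis using u by simp
    qed
    then show False using \<open>R \<noteq> S\<close> by blast
  qed
  show ?thesis using ext_hom hom_inf inf_hom inf_ext by blast
qed

end
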